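(* Let $f,h:\mathbb{R}\to\mathbb{R}$ be bounded smooth functions such that $f(y)\ge 0$ for all $y$ and $h(y)<y$ for $y>1$. Let $A=A(t,r)$, $B=B(t,r)$ be strictly positive smooth functions on $\{(t,r): t\ge 0,\ r>1\}$ which, with $x=r+t$, $y=r-t$, are given by $$A=2B\sqrt{\frac{1}{12}+\frac{f(y)}{B^3}},\qquad x=\int_{0}^{B}\frac{db}{\sqrt{\frac{1}{12}+\frac{f(y)}{b^3}}}+h(y),$$ so that the corresponding family $\varphi(t)$ of $G_2$-structures on $C(S^3\times S^3)$ is a solution of the flow $\frac{\partial\varphi}{\partial t}\wedge dr=d\varphi$. Let $g=g(t)$ be the corresponding family of metrics $$g=dr^2+\sum_{i=1}^3A^2(\eta_i+\tilde\eta_i)^2+\sum_{j=1}^3B^2(\eta_j-\tilde\eta_j)^2 .$$ Then, in terms of the space variable $s=\frac{r+t}{t+1}>1$, the rescaled metric $\frac{g}{(t+1)^2}$ converges as $t\to+\infty$ to a conical metric $$g_\infty=ds^2+s^2\, g_{S^3\times S^3},$$ where $g_{S^3\times S^3}$ is a Riemannian metric on $S^3\times S^3$ that does not depend on $s$. Here convergence means that for every $K>1$ $$\sup_{1<s\le K}\left|\frac{g}{(t+1)^2}(s,t)-g_\infty(s)\right|\to 0\quad\text{as } t\to+\infty .$$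
   Context: $C(S^3\times S^3)=(1,\infty)\times S^3\times S^3$ is the cone over $S^3\times S^3$, with coordinate $r>1$ on the first factor. On $S^3=SU(2)$ let $\xi^1,\xi^2,\xi^3$ be the left-invariant frame with values $\begin{pmatrix} i&0\\0&-i\end{pmatrix}$, $\begin{pmatrix}0&1\\-1&0\end{pmatrix}$, $\begin{pmatrix}0&i\\i&0\end{pmatrix}$ at the identity, so that $[\xi^1,\xi^2]=2\xi^3$, $[\xi^2,\xi^3]=2\xi^1$, $[\xi^3,\xi^1]=2\xi^2$. The dual left-invariant coframe $\eta_1,\eta_2,\eta_3$ satisfies $d\eta_1=-2\eta_2\wedge\eta_3$, $d\eta_2=-2\eta_3\wedge\eta_1$, $d\eta_3=-2\eta_1\wedge\eta_2$. On $S^3\times S^3$, $\eta_i$ denotes this coframe on the first factor and $\tilde\eta_i$ the same coframe on the second factor. For strictly positive smooth functions $A,B$ of $(t,r)$ put $e^i=A(\eta_i+\tilde\eta_i)$ and $e^{i+3}=B(\eta_i-\tilde\eta_i)$ for $i=1,2,3$, and $e^7=dr$. With $e^{ijk}=e^i\wedge e^j\wedge e^k$, the corresponding family of $G_2$-structures (non-degenerate 3-forms) is $$\varphi=\varphi(t)=e^{456}+e^{621}+e^{174}+e^{527}+e^{637}+e^{135}+e^{432},$$ and the Riemannian metric it determines is $g=\sum_{k=1}^7 (e^k)^2$, i.e. the metric $g$ of the statement. In the flow equation $d$ is the exterior derivative on the 7-manifold $C(S^3\times S^3)$ ($t$ is a parameter). For each fixed $t\ge0$, $r\mapsto s=\frac{r+t}{t+1}$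 is a diffeomorphism of $(1,\infty)$ onto itself with $dr=(t+1)\,ds$, and $\frac{g}{(t+1)^2}$ is viewed as a metric on $(1,\infty)_s\times S^3\times S^3$. All metrics involved have, in the fixed coframe $ds,\eta_1,\eta_2,\eta_3,\tilde\eta_1,\tilde\eta_2,\tilde\eta_3$, components depending only on $s$ and $t$; $|\cdot|$ denotes a fixed norm on the matrix of components in this coframe. *)

theory Defs
  imports "HOL-Analysis.Analysis"
begin

section \<open>Smooth functions\<close>

primrec Ck_on :: "nat \<Rightarrow> 'a::euclidean_space set \<Rightarrow> ('a \<Rightarrow> real) \<Rightarrow> bool" where
  "Ck_on 0 U f \<longleftrightarrow> continuous_on U f"
| "Ck_on (Suc k) U f \<longleftrightarrow>
     (\<forall>x\<in>U. f differentiable (at x)) \<and>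
     (\<forall>b\<in>Basis. Ck_on k U (\<lambda>x. frechet_derivative f (at x) b))"

text \<open>On a set that need not be open, smoothness means that there are local smooth extensions.\<close>

definition smooth_on :: "'a::euclidean_space set \<Rightarrow> ('a \<Rightarrow> real) \<Rightarrow> bool" where
  "smooth_on S f \<longleftrightarrow>
     (\<forall>x\<in>S. \<exists>U F. open U \<and> x \<in> U \<and> (\<forall>k. Ck_on k U F) \<and> (\<forall>y\<in>U \<inter> S. F y = f y))"


section \<open>Differential forms\<close>

text \<open>
  A \<open>k\<close>-form takes a point and a list of \<open>k\<close> vectors.  The wedge product is normalised by
  \<open>(\<alpha> \<and> \<beta>)(u, v) = \<alpha>(u) \<beta>(v) - \<alpha>(v) \<beta>(u)\<close>, which is the convention for which the
  formula in \<open>ext_deriv\<close> is the exterior derivative.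
\<close>

type_synonym 'v one_form = "'v \<Rightarrow> 'v \<Rightarrow> real"
type_synonym 'v form = "'v \<Rightarrow> 'v list \<Rightarrow> real"

definition omit :: "nat \<Rightarrow> 'v list \<Rightarrow> 'v list" where
  "omit i vs = take i vs @ drop (Suc i) vs"

definition wedge1 :: "'v form \<Rightarrow> 'v one_form \<Rightarrow> 'v form" where
  "wedge1 \<omega> \<alpha> m vs =
     (\<Sum>i<length vs. (-1) ^ (length vs - Suc i) * \<omega> m (omit i vs) * \<alpha> m (vs ! i))"

definition wedge3 :: "'v one_form \<Rightarrow> 'v one_form \<Rightarrow> 'v one_form \<Rightarrow> 'v form" where
  "wedge3 \<alpha> \<beta> \<gamma> = wedge1 (wedge1 (\<lambda>m vs. \<alpha> m (vs ! 0)) \<beta>) \<gamma>"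

definition ext_deriv :: "'v::real_normed_vector form \<Rightarrow> 'v form" where
  "ext_deriv \<omega> m vs =
     (\<Sum>i<length vs. (-1) ^ i * frechet_derivative (\<lambda>x. \<omega> x (omit i vs)) (at m) (vs ! i))"


section \<open>The group \<open>SU(2)\<close> and its invariant (co)frame\<close>

type_synonym mat2 = "complex^2^2"

definition SU2 :: "mat2 set" where
  "SU2 = {p. p ** (\<chi> i j. cnj (p $ j $ i)) = mat 1 \<and> det p = 1}"

definition xi :: "nat \<Rightarrow> mat2" where
  "xi i =
     (if i = 1 then vector [vector [\<i>, 0], vector [0, - \<i>]]
      else if i = 2 then vector [vector [0, 1], vector [-1, 0]]
      else vector [vector [0, \<i>], vector [\<i>, 0]])"

definition tangent_SU2 :: "mat2 \<Rightarrow> mat2 set" where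
  "tangent_SU2 p = (\<lambda>X. p ** X) ` span (xi ` {1, 2, 3})"

text \<open>
  The value at \<open>p\<close> of the left-invariant frame is \<open>p ** xi i\<close>.  With respect to the real inner
  product these three vectors are orthogonal of squared length \<open>2\<close> when \<open>p\<close> is in \<open>SU2\<close>, so on
  \<open>tangent_SU2 p\<close> the following is the dual coframe.  The formula also makes sense for an arbitrary
  matrix \<open>p\<close>, so it extends the coframe to 1-forms on the ambient space \<open>mat2\<close>.
\<close>

definition eta :: "nat \<Rightarrow> mat2 one_form" where
  "eta i p v = inner (p ** xi i) v / 2"

lemma xi_brackets:
  "xi 1 ** xi 2 - xi 2 ** xi 1 = 2 *\<^sub>R xi 3"
  "xi 2 ** xi 3 - xi 3 ** xi 2 = 2 *\<^sub>R xi 1"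
  "xi 3 ** xi 1 - xi 1 ** xi 3 = 2 *\<^sub>R xi 2"
  by (simp_all add: xi_def vec_eq_iff forall_2 matrix_matrix_mult_def sum_2 complex_eq_iff)

lemma inner_mult_unitary:
  fixes p X Y :: mat2
  assumes "p \<in> SU2"
  shows "inner (p ** X) (p ** Y) = inner X Y"
proof -
  define P where "P = (\<chi> i j. cnj (p $ j $ i)) "
  have "p ** P = mat 1" using assms by (simp add: SU2_def P_def)
  then have "P ** p = mat 1" by (simp add: matrix_left_right_inverse)
  then have e: "(\<Sum>k\<in>UNIV. cnj (p $ k $ i) * p $ k $ j) = (if i = j then 1 else 0)" for i j
    by (simp add: P_def vec_eq_iff matrix_matrix_mult_def mat_def)
  have e': "cnj (p $ 1 $ i) * p $ 1 $ j + cnj (p $ 2 $ i) * p $ 2 $ j = (if i = j then 1 else 0)" for i j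
    using e[of i j] by (simp add: sum_2)
  have ic: "inner a b = Re (cnj a * b)" for a b :: complex by (simp add: inner_complex_def)
  have "inner (p ** X) (p ** Y) = Re (\<Sum>l\<in>UNIV. \<Sum>i\<in>UNIV. \<Sum>j\<in>UNIV.
     cnj (X $ i $ l) * Y $ j $ l * (cnj (p $ 1 $ i) * p $ 1 $ j + cnj (p $ 2 $ i) * p $ 2 $ j))"
    unfolding inner_vec_def ic matrix_matrix_mult_def
    by (simp add: sum_2 algebra_simps)
  also have "\<dots> = inner X Y"
    unfolding e' inner_vec_def ic by (simp add: sum_2)
  finally show ?thesis .
qed

lemma eta_dual:
  assumes "p \<in> SU2" "i \<in> {1, 2, 3}" "j \<in> {1, 2, 3}"
  shows "eta i p (p ** xi j) = (if i = j then 1 else 0)"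
  using assms(2,3) unfolding eta_def inner_mult_unitary[OF assms(1)]
  by (auto simp: xi_def inner_vec_def sum_2)


section \<open>The cone over \<open>SU2 \<times> SU2\<close> and the family of \<open>G\<^sub>2\<close>-structures\<close>

type_synonym link_pt = "mat2 \<times> mat2"
type_synonym cone_pt = "real \<times> link_pt"

definition cone :: "cone_pt set" where
  "cone = {1<..} \<times> SU2 \<times> SU2"

definition tangent_link :: "link_pt \<Rightarrow> link_pt set" where
  "tangent_link n = tangent_SU2 (fst n) \<times> tangent_SU2 (snd n)"

definition tangent_cone :: "cone_pt \<Rightarrow> cone_pt set" where
  "tangent_cone m = UNIV \<times> tangent_link (snd m)"

definition eta_plus :: "nat \<Rightarrow> link_pt one_form" where
  "eta_plus i = (\<lambda>(p, q) (v, w). eta i p v + eta i q w)"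

definition eta_minus :: "nat \<Rightarrow> link_pt one_form" where
  "eta_minus i = (\<lambda>(p, q) (v, w). eta i p v - eta i q w)"

definition dr :: "cone_pt one_form" where
  "dr m u = fst u"

definition coframe ::
    "(real \<Rightarrow> real \<Rightarrow> real) \<Rightarrow> (real \<Rightarrow> real \<Rightarrow> real) \<Rightarrow> real \<Rightarrow> nat \<Rightarrow> cone_pt one_form" where
  "coframe A B t k m u =
     (if k \<in> {1, 2, 3} then A t (fst m) * eta_plus k (snd m) (snd u)
      else if k \<in> {4, 5, 6} then B t (fst m) * eta_minus (k - 3) (snd m) (snd u)
      else dr m u)"

definition phi ::
    "(real \<Rightarrow> real \<Rightarrow> real) \<Rightarrow> (real \<Rightarrow> real \<Rightarrow> real) \<Rightarrow> real \<Rightarrow> cone_pt form" where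
  "phi A B t m vs =
     (let e = (\<lambda>i j k. wedge3 (coframe A B t i) (coframe A B t j) (coframe A B t k) m vs)
      in e 4 5 6 + e 6 2 1 + e 1 7 4 + e 5 2 7 + e 6 3 7 + e 1 3 5 + e 4 3 2)"

text \<open>
  \<open>phi A B t\<close> is defined on an open subset of the ambient vector space.  As the exterior derivative
  commutes with restriction to a submanifold, the equation \<open>\<partial>\<phi>/\<partial>t \<and> dr = d\<phi>\<close> on the cone is the
  equality of both sides, computed in the ambient space, on tangent vectors of the cone.  The time
  derivative at \<open>t = 0\<close> is one-sided.
\<close>

definition solves_flow :: "(real \<Rightarrow> cone_pt form) \<Rightarrow> bool" where
  "solves_flow \<phi> \<longleftrightarrow>
     (\<forall>t\<ge>0. \<forall>m\<in>cone. \<forall>vs. length vs = 4 \<longrightarrow> set vs \<subseteq> tangent_cone m \<longrightarrow>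
        wedge1 (\<lambda>m' us. vector_derivative (\<lambda>\<tau>. \<phi> \<tau> m' us) (at t within {0..})) dr m vs
          = ext_deriv (\<phi> t) m vs)"


section \<open>Metrics\<close>

type_synonym 'v tensor2 = "'v \<Rightarrow> 'v \<Rightarrow> 'v \<Rightarrow> real"

definition cone_metric ::
    "(real \<Rightarrow> real \<Rightarrow> real) \<Rightarrow> (real \<Rightarrow> real \<Rightarrow> real) \<Rightarrow> real \<Rightarrow> cone_pt tensor2" where
  "cone_metric A B t m u v =
     dr m u * dr m v
     + (\<Sum>i=1..3. (A t (fst m))\<^sup>2 * (eta_plus i (snd m) (snd u) * eta_plus i (snd m) (snd v)))
     + (\<Sum>j=1..3. (B t (fst m))\<^sup>2 * (eta_minus j (snd m) (snd u) * eta_minus j (snd m) (snd v)))"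

text \<open>The diffeomorphism \<open>(s, n) \<mapsto> (r, n)\<close> inverse to \<open>s = (r + t) / (t + 1)\<close>.\<close>

definition rescaling :: "real \<Rightarrow> cone_pt \<Rightarrow> cone_pt" where
  "rescaling t = (\<lambda>(s, n). ((t + 1) * s - t, n))"

lemma rescaling_inverse:
  "t \<ge> 0 \<Longrightarrow> rescaling t (s, n) = (r, n) \<longleftrightarrow> s = (r + t) / (t + 1)"
  by (auto simp: rescaling_def field_simps)

definition pullback :: "('v::real_normed_vector \<Rightarrow> 'v) \<Rightarrow> 'v tensor2 \<Rightarrow> 'v tensor2" where
  "pullback F g m u v =
     g (F m) (frechet_derivative F (at m) u) (frechet_derivative F (at m) v)"

definition rescaled_metric ::
    "(real \<Rightarrow> real \<Rightarrow> real) \<Rightarrow> (real \<Rightarrow> real \<Rightarrow> real) \<Rightarrow> real \<Rightarrow> cone_pt tensor2" where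
  "rescaled_metric A B t m u v =
     pullback (rescaling t) (cone_metric A B t) m u v / (t + 1)\<^sup>2"

definition conical_metric :: "link_pt tensor2 \<Rightarrow> cone_pt tensor2" where
  "conical_metric \<gamma> m u v =
     fst u * fst v + (fst m)\<^sup>2 * \<gamma> (snd m) (snd u) (snd v)"

definition link_frame :: "nat \<Rightarrow> link_pt \<Rightarrow> link_pt" where
  "link_frame i n = (if i \<le> 3 then (fst n ** xi i, 0) else (0, snd n ** xi (i - 3)))"

definition riemannian_metric_link :: "link_pt tensor2 \<Rightarrow> bool" where
  "riemannian_metric_link \<gamma> \<longleftrightarrow>
     (\<forall>n \<in> SU2 \<times> SU2. let T = tangent_link n in
        (\<forall>u\<in>T. \<forall>v\<in>T. \<forall>w\<in>T. \<forall>a b. \<gamma> n (a *\<^sub>R u + b *\<^sub>R v) w = a * \<gamma> n u w + b * \<gamma> n v w) \<and>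
        (\<forall>u\<in>T. \<forall>v\<in>T. \<gamma> n u v = \<gamma> n v u) \<and>
        (\<forall>u\<in>T. u \<noteq> 0 \<longrightarrow> \<gamma> n u u > 0)) \<and>
     (\<forall>i\<in>{1..6}. \<forall>j\<in>{1..6}.
        smooth_on (SU2 \<times> SU2) (\<lambda>n. \<gamma> n (link_frame i n) (link_frame j n)))"

text \<open>
  The frame dual to \<open>ds, \<eta>\<^sub>1, \<eta>\<^sub>2, \<eta>\<^sub>3\<close> (first factor), \<open>\<eta>\<^sub>1, \<eta>\<^sub>2, \<eta>\<^sub>3\<close> (second factor), and the
  Euclidean norm of the difference of the two \<open>7 \<times> 7\<close> component matrices.
\<close>

definition cone_frame :: "nat \<Rightarrow> cone_pt \<Rightarrow> cone_pt" where
  "cone_frame i m = (if i = 0 then (1, 0) else (0, link_frame i (snd m)))"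

definition metric_dist :: "cone_pt tensor2 \<Rightarrow> cone_pt tensor2 \<Rightarrow> cone_pt \<Rightarrow> real" where
  "metric_dist g g' m =
     L2_set (\<lambda>(i, j). g m (cone_frame i m) (cone_frame j m) - g' m (cone_frame i m) (cone_frame j m))
       ({..6} \<times> {..6})"

end

theory Submission
  imports Defs
begin

text \<open>
  For \<open>b\<close> large the integrand \<open>1 / sqrt (1/12 + f/b\<^sup>3)\<close> differs from \<open>sqrt 12\<close> by \<open>O(b\<^sup>-\<^sup>2)\<close>, uniformly
  since \<open>f\<close> is bounded, so \<open>sqrt 12 * B = r + t + O(1)\<close>.  As \<open>r + t = (t + 1) s\<close>, dividing by
  \<open>t + 1\<close> gives \<open>B\<^sup>2 / (t + 1)\<^sup>2 \<rightarrow> s\<^sup>2 / 12\<close>, and \<open>A\<^sup>2 = B\<^sup>2 / 3 + 4 f / B\<close> gives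
  \<open>A\<^sup>2 / (t + 1)\<^sup>2 \<rightarrow> s\<^sup>2 / 36\<close>, both uniformly in \<open>1 < s \<le> K\<close>.
\<close>

section \<open>Estimates for the integral that determines \<open>B\<close>\<close>

text \<open>With \<open>u = 12 * c / b ^ 3\<close> the integrand equals
  \<open>sqrt 12 / sqrt (1 + u)\<close>, and
  \<open>1 - u / 2 \<le> 1 / sqrt (1 + u) \<le> 1\<close>. The loss is stated as a multiple of
  \<open>1 / (1 + b)\<^sup>2\<close> because this stays integrable down to \<open>b = 0\<close> and
  has an elementary antiderivative. At \<open>b = 0\<close> itself the convention
  \<open>c / 0 = 0\<close> makes the integrand \<open>sqrt 12\<close>.\<close>

lemma integrand_bounds:
  fixes b c F :: real
  assumes "0 \<le> c" "c \<le> F" "0 \<le> b"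
  shows "1 / sqrt (1 / 12 + c / b ^ 3) \<le> sqrt 12"
    and "sqrt 12 - sqrt 12 * (4 + 24 * F) / (1 + b)\<^sup>2 \<le> 1 / sqrt (1 / 12 + c / b ^ 3)"
proof -
  define u where "u = 12 * c / b ^ 3"
  have u0: "u \<ge> 0" using assms by (simp add: u_def)
  have "1 / 12 + c / b ^ 3 = (1 + u) / 12" by (simp add: u_def add_divide_distrib)
  then have eq: "1 / sqrt (1 / 12 + c / b ^ 3) = sqrt 12 * (1 / sqrt (1 + u))"
    by (simp only: real_sqrt_divide) simp
  have "1 / sqrt (1 + u) \<le> 1" using u0 by simp
  then have "sqrt 12 * (1 / sqrt (1 + u)) \<le> sqrt 12 * 1" by (intro mult_left_mono) auto
  then show "1 / sqrt (1 / 12 + c / b ^ 3) \<le> sqrt 12" using eq by simp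
  have "1 - (4 + 24 * F) / (1 + b)\<^sup>2 \<le> 1 / sqrt (1 + u)"
  \<comment> \<open>The two summands of \<open>4 + 24 * F\<close> serve the two cases: for
    \<open>b \<le> 1\<close> the \<open>4\<close> already makes the left side nonpositive, and for
    \<open>b > 1\<close> the \<open>24 * F\<close> dominates \<open>u / 2\<close>, since
    \<open>(1 + b)\<^sup>2 \<le> 4 * b ^ 3\<close>.\<close>
  proof (cases "b \<le> 1")
    case True
    have "(1 + b)\<^sup>2 \<le> 2\<^sup>2" using True assms by (intro power_mono) auto
    then have "1 \<le> (4 + 24 * F) / (1 + b)\<^sup>2" using assms by (simp add: le_divide_eq)
    moreover have "0 \<le> 1 / sqrt (1 + u)" using u0 by simp
    ultimately show ?thesis by linarith
  next
    case False
    have "sqrt (1 + u) \<le> 1 + u / 2"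
      using u0 by (intro real_le_lsqrt) (auto simp: power2_eq_square algebra_simps)
    then have "1 / (1 + u / 2) \<le> 1 / sqrt (1 + u)" using u0 by (intro divide_left_mono) auto
    moreover have "1 - u / 2 \<le> 1 / (1 + u / 2)" using u0 by (simp add: field_simps)
    moreover have "u / 2 \<le> (4 + 24 * F) / (1 + b)\<^sup>2"
    proof -
      have "(1 + b)\<^sup>2 \<le> (2 * b)\<^sup>2" using False by (intro power_mono) auto
      also have "\<dots> \<le> 4 * b ^ 3" using False by (simp add: power2_eq_square power3_eq_cube)
      finally have "6 * c * (1 + b)\<^sup>2 \<le> 6 * c * (4 * b ^ 3)" using assms by (intro mult_left_mono) auto
      also have "\<dots> = 24 * c * b ^ 3" by simp
      also have "\<dots> \<le> (4 + 24 * F) * b ^ 3" using assms by (intro mult_right_mono) auto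
      finally show ?thesis using False by (simp add: u_def divide_simps mult.commute)
    qed
    ultimately show ?thesis by linarith
  qed
  then have "sqrt 12 * (1 - (4 + 24 * F) / (1 + b)\<^sup>2) \<le> sqrt 12 * (1 / sqrt (1 + u))"
    by (intro mult_left_mono) auto
  then show "sqrt 12 - sqrt 12 * (4 + 24 * F) / (1 + b)\<^sup>2 \<le> 1 / sqrt (1 / 12 + c / b ^ 3)"
    using eq by (simp add: algebra_simps)
qed

text \<open>Integrating the pointwise bounds gives this: the error
  \<open>C / (1 + b)\<^sup>2\<close> has total mass at most \<open>C\<close> on every
  \<open>{0..B}\<close>, so the loss in the lower bound does not grow with \<open>B\<close>.\<close>

lemma integral_bounds:
  fixes B c F :: real
  assumes "0 \<le> c" "c \<le> F" "0 \<le> B"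
  defines "I \<equiv> integral {0..B} (\<lambda>b. 1 / sqrt (1 / 12 + c / b ^ 3))"
  shows "I \<le> sqrt 12 * B" and "sqrt 12 * B - sqrt 12 * (4 + 24 * F) \<le> I"
proof -
  let ?g = "\<lambda>b. 1 / sqrt (1 / 12 + c / b ^ 3)"
  have nonneg: "0 \<le> ?g b" if "b \<in> {0..B}" for b using that assms by auto
  \<comment> \<open>For \<open>c > 0\<close> the integrand jumps at \<open>0\<close>, from the value
    \<open>sqrt 12\<close> to the right limit \<open>0\<close>; integrability therefore comes from
    measurability and boundedness, not from continuity.\<close>
  have "?g \<in> borel_measurable borel" by measurable
  then have "?g \<in> borel_measurable (lebesgue_on {0..B})"
    by (simp add: measurable_completion measurable_restrict_space1)
  then have int: "?g integrable_on {0..B}"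
    by (rule measurable_bounded_by_integrable_imp_integrable[where g = "\<lambda>_. sqrt 12"])
       (use nonneg integrand_bounds(1)[OF assms(1,2)] in auto)
  have "I \<le> integral {0..B} (\<lambda>_. sqrt 12)"
    unfolding I_def using int integrand_bounds(1)[OF assms(1,2)] by (intro integral_le) auto
  then show "I \<le> sqrt 12 * B" using assms by (simp add: mult.commute)
  define C where "C = sqrt 12 * (4 + 24 * F)"
  have C0: "C \<ge> 0" using assms by (simp add: C_def)
  have low: "((\<lambda>b. sqrt 12 - C / (1 + b)\<^sup>2) has_integral
      (sqrt 12 * B + C / (1 + B)) - (sqrt 12 * 0 + C / (1 + 0))) {0..B}"
    using assms
    by (intro fundamental_theorem_of_calculus)
       (auto simp flip: has_real_derivative_iff_has_vector_derivative
          intro!: derivative_eq_intros simp: power2_eq_square)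
  have "(sqrt 12 * B + C / (1 + B)) - (sqrt 12 * 0 + C / (1 + 0)) \<le> I"
    by (rule has_integral_le[OF low])
       (use int integrand_bounds(2)[OF assms(1,2)] in \<open>auto simp: I_def C_def\<close>)
  moreover have "0 \<le> C / (1 + B)" using C0 assms by simp
  ultimately show "sqrt 12 * B - sqrt 12 * (4 + 24 * F) \<le> I" by (simp add: C_def)
qed

section \<open>Elementary facts on bounded and on constant functions\<close>

lemma bounded_rangeE:
  fixes f :: "'a \<Rightarrow> real"
  assumes "bounded (range f)"
  obtains C where "C \<ge> 0" "\<And>y. \<bar>f y\<bar> \<le> C"
proof -
  obtain C where "\<And>y. \<bar>f y\<bar> \<le> C" using assms by (auto simp: bounded_iff)
  moreover from this[of undefined] have "C \<ge> 0" by linarith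
  ultimately show ?thesis using that by blast
qed

lemma Ck_on_const: "Ck_on k U (\<lambda>_. c)"
  by (induction k arbitrary: c) auto

lemma smooth_on_const:
  assumes "\<And>x. x \<in> S \<Longrightarrow> f x = c"
  shows "smooth_on S f"
  unfolding smooth_on_def
  by (intro ballI exI[of _ UNIV] exI[of _ "\<lambda>_. c"]) (use assms Ck_on_const in auto)

section \<open>The left-invariant coframe and the metrics it defines on the link\<close>

lemma mat_1_in_SU2: "mat 1 \<in> SU2"
  by (simp add: SU2_def vec_eq_iff matrix_matrix_mult_def mat_def forall_2 sum_2 det_2)

lemma eta_zero [simp]: "eta i p 0 = 0"
  by (simp add: eta_def)

lemma eta_linear: "eta i p (a *\<^sub>R u + b *\<^sub>R v) = a * eta i p u + b * eta i p v"
  by (simp add: eta_def inner_add_right add_divide_distrib)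

text \<open>Left translation by \<open>p\<close> preserves the inner product, so the translate of
  \<open>v\<close> back to the identity is orthogonal to every \<open>xi i\<close>. It lies in their
  span, hence is orthogonal to itself. This yields definiteness of the link metrics.\<close>

lemma eta_eq_0_imp_eq_0:
  assumes "p \<in> SU2" "v \<in> tangent_SU2 p" "\<And>i. i \<in> {1, 2, 3} \<Longrightarrow> eta i p v = 0"
  shows "v = 0"
proof -
  obtain X where X: "X \<in> span (xi ` {1, 2, 3})" "v = p ** X"
    using assms(2) by (auto simp: tangent_SU2_def)
  have "inner (xi i) X = 0" if "i \<in> {1, 2, 3}" for i
    using assms(3)[OF that] by (simp add: eta_def X(2) inner_mult_unitary[OF assms(1)])
  note X0 = this
  have "inner X Y = 0" if "Y \<in> span (xi ` {1, 2, 3})" for Y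
    using that by (induction rule: span_induct_alt) (use X0 in \<open>auto simp: inner_add_right inner_commute[of X]\<close>)
  then have "X = 0" using X(1) inner_eq_zero_iff by blast
  then show ?thesis by (simp add: X(2) matrix_matrix_mult_def vec_eq_iff)
qed

lemma eta_plus_apply:
  "eta_plus i n u = eta i (fst n) (fst u) + eta i (snd n) (snd u)"
  by (simp add: eta_plus_def case_prod_beta)

lemma eta_minus_apply:
  "eta_minus i n u = eta i (fst n) (fst u) - eta i (snd n) (snd u)"
  by (simp add: eta_minus_def case_prod_beta)

lemma eta_pm_link_frame:
  assumes "n \<in> SU2 \<times> SU2" "i \<in> {1, 2, 3}" "j \<in> {1..6}"
  shows "eta_plus i n (link_frame j n) = (if i = j \<or> i + 3 = j then 1 else 0)"
    and "eta_minus i n (link_frame j n) = (if i = j then 1 else if i + 3 = j then -1 else 0)"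
proof -
  have "j \<le> 3 \<Longrightarrow> j \<in> {1, 2, 3}" "\<not> j \<le> 3 \<Longrightarrow> j - 3 \<in> {1, 2, 3}" using assms(3) by auto
  then show "eta_plus i n (link_frame j n) = (if i = j \<or> i + 3 = j then 1 else 0)"
    and "eta_minus i n (link_frame j n) = (if i = j then 1 else if i + 3 = j then -1 else 0)"
    using assms eta_dual[of "fst n" i j] eta_dual[of "snd n" i "j - 3"]
    by (auto simp: eta_plus_apply eta_minus_apply link_frame_def mem_Times_iff)
qed

text \<open>The coefficients may have any sign, so that the difference of two such metrics is again
  of this form.\<close>

definition link_metric :: "real \<Rightarrow> real \<Rightarrow> link_pt tensor2" where
  "link_metric a b n u v =
     a * (\<Sum>i=1..3. eta_plus i n u * eta_plus i n v)
     + b * (\<Sum>i=1..3. eta_minus i n u * eta_minus i n v)"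

lemma sum_1_3: "(\<Sum>i=1..3::nat. F i) = F 1 + F 2 + (F 3 :: real)"
  by (simp add: numeral_3_eq_3 numeral_2_eq_2)

text \<open>If both sums of squares vanish, adding and subtracting \<open>eta_plus\<close> and
  \<open>eta_minus\<close> kills the coframe on each factor, which forces
  \<open>u = 0\<close>.\<close>

lemma riemannian_link_metric:
  assumes "a > 0" "b > 0"
  shows "riemannian_metric_link (link_metric a b)"
  unfolding riemannian_metric_link_def Let_def
proof (intro conjI ballI allI impI)
  fix n u v w :: link_pt and x y :: real
  show "link_metric a b n (x *\<^sub>R u + y *\<^sub>R v) w = x * link_metric a b n u w + y * link_metric a b n v w"
    unfolding link_metric_def sum_1_3 eta_plus_apply eta_minus_apply
    by (simp add: eta_linear algebra_simps)
  show "link_metric a b n u v = link_metric a b n v u"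
    by (simp add: link_metric_def mult.commute)
next
  fix n u :: link_pt
  assume n: "n \<in> SU2 \<times> SU2" and u: "u \<in> tangent_link n" "u \<noteq> 0"
  let ?P = "\<Sum>i=1..3. eta_plus i n u * eta_plus i n u"
  let ?M = "\<Sum>i=1..3. eta_minus i n u * eta_minus i n u"
  have nonneg: "?P \<ge> 0" "?M \<ge> 0" by (auto intro!: sum_nonneg)
  have "\<not> (?P = 0 \<and> ?M = 0)"
  proof
    assume "?P = 0 \<and> ?M = 0"
    then have PM: "eta_plus i n u = 0 \<and> eta_minus i n u = 0" if "i \<in> {1, 2, 3}" for i
      using that by (auto simp: sum_nonneg_eq_0_iff)
    have "eta i (fst n) (fst u) = 0 \<and> eta i (snd n) (snd u) = 0" if "i \<in> {1, 2, 3}" for i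
      using that[THEN PM] by (auto simp: eta_plus_apply eta_minus_apply)
    then have "fst u = 0" "snd u = 0"
      using n u(1) eta_eq_0_imp_eq_0 by (auto simp: tangent_link_def mem_Times_iff)
    with u(2) show False by (simp add: prod_eq_iff)
  qed
  with nonneg have "?P > 0 \<or> ?M > 0" by linarith
  then show "link_metric a b n u u > 0"
    unfolding link_metric_def using assms nonneg
    by (auto intro: add_pos_nonneg add_nonneg_pos)
next
  fix i j :: nat
  assume ij: "i \<in> {1..6}" "j \<in> {1..6}"
  \<comment> \<open>By left invariance the components in \<open>link_frame\<close> are constant,
    equal to those at the identity \<open>?o\<close>; smoothness is then that of a constant.\<close>
  let ?o = "(mat 1, mat 1) :: link_pt"
  have o: "?o \<in> SU2 \<times> SU2" by (simp add: mat_1_in_SU2)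
  have "link_metric a b n (link_frame i n) (link_frame j n)
      = link_metric a b ?o (link_frame i ?o) (link_frame j ?o)" if n: "n \<in> SU2 \<times> SU2" for n
    unfolding link_metric_def sum_1_3
    by (simp add: eta_pm_link_frame[OF n _ ij(1)] eta_pm_link_frame[OF n _ ij(2)]
      eta_pm_link_frame[OF o _ ij(1)] eta_pm_link_frame[OF o _ ij(2)])
  then show "smooth_on (SU2 \<times> SU2) (\<lambda>n. link_metric a b n (link_frame i n) (link_frame j n))"
    by (rule smooth_on_const)
qed

section \<open>Pullback under the rescaling and comparison of components\<close>

lemma frechet_derivative_rescaling:
  "frechet_derivative (rescaling t) (at m) = (\<lambda>u. ((t + 1) * fst u, snd u))"
proof -
  have "(rescaling t has_derivative (\<lambda>u. ((t + 1) * fst u, snd u))) (at m)"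
    unfolding rescaling_def case_prod_beta
    by (auto intro!: derivative_eq_intros)
  then show ?thesis by (rule frechet_derivative_at[symmetric])
qed

text \<open>The form \<open>dr\<close> pulls back to \<open>(t + 1) ds\<close>, so after division by
  \<open>(t + 1)\<^sup>2\<close> the radial terms cancel exactly. Convergence of metrics thus
  reduces to that of two scalar coefficients.\<close>

lemma rescaled_metric_minus_conical:
  assumes "t \<ge> 0"
  shows "rescaled_metric A B t (s, n) u v - conical_metric (link_metric a b) (s, n) u v =
    link_metric ((A t ((t + 1) * s - t) / (t + 1))\<^sup>2 - a * s\<^sup>2)
      ((B t ((t + 1) * s - t) / (t + 1))\<^sup>2 - b * s\<^sup>2) n (snd u) (snd v)"
proof -
  have "((t + 1) * fst u * ((t + 1) * fst v) + (\<alpha> + \<beta>)) / (t + 1)\<^sup>2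
      = fst u * fst v + (\<alpha> / (t + 1)\<^sup>2 + \<beta> / (t + 1)\<^sup>2)" for \<alpha> \<beta>
    using assms by (simp add: power2_eq_square add_divide_distrib)
  then show ?thesis
    unfolding rescaled_metric_def pullback_def frechet_derivative_rescaling cone_metric_def
      dr_def conical_metric_def link_metric_def sum_distrib_left[symmetric] add.assoc fst_conv
    by (simp add: rescaling_def power_divide left_diff_distrib right_diff_distrib distrib_left
        mult.assoc mult.left_commute)
qed

text \<open>On frame vectors \<open>eta_plus\<close> and \<open>eta_minus\<close> only take the
  values \<open>0\<close>, \<open>1\<close>, \<open>-1\<close>, and each sum has three terms. Index
  \<open>0\<close> is the radial direction, whose link component is zero.\<close>

lemma link_metric_frame_bound:
  assumes "n \<in> SU2 \<times> SU2" "i \<le> 6" "j \<le> 6"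
  shows "\<bar>link_metric a b n (snd (cone_frame i (s, n))) (snd (cone_frame j (s, n)))\<bar>
    \<le> 3 * \<bar>a\<bar> + 3 * \<bar>b\<bar>"
proof -
  define e where "e k = snd (cone_frame k (s, n))" for k
  have le1: "\<bar>eta_plus l n (e k)\<bar> \<le> 1 \<and> \<bar>eta_minus l n (e k)\<bar> \<le> 1"
    if "k \<le> 6" "l \<in> {1..3}" for k l
  proof (cases "k = 0")
    case True
    then show ?thesis by (simp add: e_def cone_frame_def eta_plus_apply eta_minus_apply)
  next
    case False
    then have "l \<in> {1, 2, 3}" "k \<in> {1..6}" using that by auto
    with False show ?thesis by (simp add: e_def cone_frame_def eta_pm_link_frame[OF assms(1)])
  qed
  have "\<bar>\<Sum>l=1..3. eta_plus l n (e i) * eta_plus l n (e j)\<bar> \<le> (\<Sum>l=1..3::nat. 1)"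
    using le1 assms(2,3)
    by (intro order_trans[OF sum_abs] sum_mono) (auto simp: abs_mult intro!: mult_le_one)
  moreover have "\<bar>\<Sum>l=1..3. eta_minus l n (e i) * eta_minus l n (e j)\<bar> \<le> (\<Sum>l=1..3::nat. 1)"
    using le1 assms(2,3)
    by (intro order_trans[OF sum_abs] sum_mono) (auto simp: abs_mult intro!: mult_le_one)
  ultimately have "\<bar>link_metric a b n (e i) (e j)\<bar> \<le> \<bar>a\<bar> * 3 + \<bar>b\<bar> * 3"
    unfolding link_metric_def
    by (intro order_trans[OF abs_triangle_ineq] add_mono)
       (auto simp: abs_mult intro!: mult_left_mono)
  then show ?thesis by (simp add: e_def)
qed

text \<open>The Euclidean norm is at most the sum of the absolute values of the
  \<open>7 * 7 = 49\<close> entries.\<close>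

lemma metric_dist_le:
  assumes "\<And>i j. i \<le> 6 \<Longrightarrow> j \<le> 6 \<Longrightarrow>
    \<bar>g m (cone_frame i m) (cone_frame j m) - g' m (cone_frame i m) (cone_frame j m)\<bar> \<le> d"
  shows "metric_dist g g' m \<le> 49 * d"
proof -
  have "metric_dist g g' m \<le> (\<Sum>(i, j)\<in>{..6::nat} \<times> {..6::nat}.
      \<bar>g m (cone_frame i m) (cone_frame j m) - g' m (cone_frame i m) (cone_frame j m)\<bar>)"
    unfolding metric_dist_def
    by (rule order_trans[OF L2_set_le_sum_abs]) (simp add: case_prod_beta)
  also have "\<dots> \<le> (\<Sum>p\<in>{..6::nat} \<times> {..6::nat}. d)"
    using assms by (intro sum_mono) auto
  finally show ?thesis by simp
qed

section \<open>Asymptotics of \<open>A\<close> and \<open>B\<close> and uniform convergence\<close>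

theorem theorem3:
  fixes f h :: "real \<Rightarrow> real" and A B :: "real \<Rightarrow> real \<Rightarrow> real"
  assumes f_smooth: "smooth_on UNIV f" and h_smooth: "smooth_on UNIV h"
    and f_bounded: "bounded (range f)" and h_bounded: "bounded (range h)"
    and f_nonneg: "\<And>y. f y \<ge> 0" and h_less: "\<And>y. y > 1 \<Longrightarrow> h y < y"
    and A_smooth: "smooth_on ({0..} \<times> {1<..}) (\<lambda>(t, r). A t r)"
    and B_smooth: "smooth_on ({0..} \<times> {1<..}) (\<lambda>(t, r). B t r)"
    and A_pos: "\<And>t r. t \<ge> 0 \<Longrightarrow> r > 1 \<Longrightarrow> A t r > 0"
    and B_pos: "\<And>t r. t \<ge> 0 \<Longrightarrow> r > 1 \<Longrightarrow> B t r > 0"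
    and A_eq: "\<And>t r. t \<ge> 0 \<Longrightarrow> r > 1 \<Longrightarrow>
        A t r = 2 * B t r * sqrt (1 / 12 + f (r - t) / (B t r) ^ 3)"
    and B_eq: "\<And>t r. t \<ge> 0 \<Longrightarrow> r > 1 \<Longrightarrow>
        r + t = integral {0..B t r} (\<lambda>b. 1 / sqrt (1 / 12 + f (r - t) / b ^ 3)) + h (r - t)"
    and flow: "solves_flow (phi A B)"
  shows "\<exists>\<gamma>. riemannian_metric_link \<gamma> \<and>
    (\<forall>K>1. ((\<lambda>t. SUP m \<in> {1<..K} \<times> SU2 \<times> SU2.
               ereal (metric_dist (rescaled_metric A B t) (conical_metric \<gamma>) m))
             \<longlongrightarrow> 0) at_top)"
proof -
  obtain F where F: "F \<ge> 0" "\<And>y. \<bar>f y\<bar> \<le> F" using bounded_rangeE[OF f_bounded] by blast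
  obtain H where H: "H \<ge> 0" "\<And>y. \<bar>h y\<bar> \<le> H" using bounded_rangeE[OF h_bounded] by blast
  \<comment> \<open>\<open>D\<close> bounds the distance of \<open>B\<close> from
    \<open>(r + t) / sqrt 12\<close>: the first summand is the loss in the integral divided by
    \<open>sqrt 12\<close>, and \<open>H\<close> absorbs \<open>h\<close> because
    \<open>1 \<le> sqrt 12\<close>.\<close>
  define D where "D = (4 + 24 * F) + H"
  have D0: "D \<ge> 0" using F H by (simp add: D_def)
  have sqrt12: "1 \<le> sqrt 12" "sqrt 12 \<le> 4" by (auto intro: real_le_lsqrt)

  have B_asymp: "\<bar>B t r - (r + t) / sqrt 12\<bar> \<le> D" if "t \<ge> 0" "r > 1" for t r
  proof -
    define I where "I = integral {0..B t r} (\<lambda>b. 1 / sqrt (1 / 12 + f (r - t) / b ^ 3))"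
    have f: "0 \<le> f (r - t)" "f (r - t) \<le> F" using f_nonneg F(2)[of "r - t"] by auto
    have I: "I \<le> sqrt 12 * B t r" "sqrt 12 * B t r - sqrt 12 * (4 + 24 * F) \<le> I"
      unfolding I_def using integral_bounds[OF f less_imp_le[OF B_pos[OF that]]] by auto
    have x: "r + t = I + h (r - t)" using B_eq[OF that] by (simp add: I_def)
    have "H * 1 \<le> H * sqrt 12" using H sqrt12 by (intro mult_left_mono) auto
    moreover have "0 \<le> sqrt 12 * (4 + 24 * F)" using F(1) by simp
    ultimately have "\<bar>sqrt 12 * B t r - (r + t)\<bar> \<le> sqrt 12 * D"
      using I x H(2)[of "r - t"] unfolding D_def by (simp add: algebra_simps abs_le_iff)
    moreover have "sqrt 12 * B t r - (r + t) = sqrt 12 * (B t r - (r + t) / sqrt 12)"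
      by (simp add: right_diff_distrib)
    ultimately show ?thesis by (simp add: abs_mult)
  qed

  \<comment> \<open>The first summand bounds the error in the square of \<open>B\<close>; the second
    bounds the extra term \<open>4 * f / B\<close> in the square of \<open>A\<close>, after
    rescaling.\<close>
  define d where "d K t = D / (t + 1) * (2 * K + D) + 4 * F / (t + 1)" for K t :: real
  have close: "\<bar>(A t r / (t + 1))\<^sup>2 - 1 / 36 * s\<^sup>2\<bar> \<le> d K t \<and>
      \<bar>(B t r / (t + 1))\<^sup>2 - 1 / 12 * s\<^sup>2\<bar> \<le> d K t"
    if s: "1 < s" "s \<le> K" and t: "t \<ge> 4 * (D + 1)" and r: "r = (t + 1) * s - t" for s t r K
  proof -
    have t0: "t \<ge> 0" using t D0 by simp
    have "(t + 1) * 1 < (t + 1) * s" using s t0 by (intro mult_strict_left_mono) auto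
    then have r1: "r > 1" using r by simp
    define \<beta> where "\<beta> = B t r / (t + 1)"
    \<comment> \<open>\<open>q\<close> is the limit of \<open>\<beta>\<close>: since
      \<open>r + t = (t + 1) * s\<close>, the leading term of \<open>B t r\<close> is
      \<open>(t + 1) * q\<close>. The limits of the squares are \<open>q\<^sup>2\<close> for
      \<open>B\<close> and \<open>q\<^sup>2 / 3\<close> for \<open>A\<close>.\<close>
    define q where "q = s / sqrt 12"
    have q2: "q\<^sup>2 = 1 / 12 * s\<^sup>2" by (simp add: q_def power_divide)
    have "q \<le> s / 1" unfolding q_def using s sqrt12 by (intro divide_left_mono) auto
    then have q: "0 \<le> q" "q \<le> K" using s by (auto simp: q_def)
    have Bd: "\<bar>B t r - (t + 1) * q\<bar> \<le> D" using B_asymp[OF t0 r1] by (simp add: r q_def)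
    have "\<beta> - q = (B t r - (t + 1) * q) / (t + 1)" using t0 by (simp add: \<beta>_def field_simps)
    then have bq: "\<bar>\<beta> - q\<bar> \<le> D / (t + 1)" using Bd t0 by (simp add: divide_right_mono)
    have "D / (t + 1) \<le> D" using D0 t0 by (simp add: divide_le_eq mult_le_cancel_left1)
    then have sum: "\<bar>\<beta> + q\<bar> \<le> 2 * K + D" using bq q by (simp add: abs_le_iff)
    have "\<beta>\<^sup>2 - q\<^sup>2 = (\<beta> - q) * (\<beta> + q)" by (simp add: power2_eq_square algebra_simps)
    then have b2: "\<bar>\<beta>\<^sup>2 - q\<^sup>2\<bar> \<le> D / (t + 1) * (2 * K + D)"
      using mult_mono[OF bq sum] D0 t0 by (simp add: abs_mult)
    \<comment> \<open>From \<open>s > 1\<close> and \<open>sqrt 12 \<le> 4\<close>. Together with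
      \<open>t \<ge> 4 * (D + 1)\<close> this keeps \<open>B t r\<close> at least \<open>1\<close>,
      so that \<open>4 * f / B\<close> is at most \<open>4 * F\<close>.\<close>
    have "1 / 4 \<le> q" using s sqrt12 by (simp add: q_def le_divide_eq)
    then have "(t + 1) * (1 / 4) \<le> (t + 1) * q" using t0 by (intro mult_left_mono) auto
    with Bd t have B1: "B t r \<ge> 1" unfolding abs_le_iff by (simp add: field_simps)
    have f: "0 \<le> f (r - t)" "f (r - t) \<le> F" using f_nonneg F(2)[of "r - t"] by auto
    have "(A t r)\<^sup>2 = 4 * (B t r)\<^sup>2 * (1 / 12 + f (r - t) / (B t r) ^ 3)"
      using A_eq[OF t0 r1] B1 f by (simp add: power_mult_distrib)
    also have "\<dots> = (B t r)\<^sup>2 / 3 + 4 * f (r - t) / B t r"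
      using B1 by (simp add: field_simps power2_eq_square power3_eq_cube)
    finally have A2: "(A t r / (t + 1))\<^sup>2 = \<beta>\<^sup>2 / 3 + 4 * f (r - t) / B t r / (t + 1)\<^sup>2"
      by (simp add: \<beta>_def power_divide add_divide_distrib)
    define \<epsilon> where "\<epsilon> = 4 * f (r - t) / B t r / (t + 1)\<^sup>2"
    have e0: "\<epsilon> \<ge> 0" using f B1 by (simp add: \<epsilon>_def)
    have "4 * f (r - t) / B t r \<le> 4 * F / 1" using f B1 F(1) by (intro frac_le) auto
    moreover have "t + 1 \<le> (t + 1)\<^sup>2" using t0 by (simp add: power2_eq_square)
    ultimately have e1: "\<epsilon> \<le> 4 * F / (t + 1)"
      unfolding \<epsilon>_def using f B1 t0 F(1) by (intro frac_le) auto
    have "\<bar>(\<beta>\<^sup>2 / 3 + \<epsilon>) - q\<^sup>2 / 3\<bar> \<le> d K t" "\<bar>\<beta>\<^sup>2 - q\<^sup>2\<bar> \<le> d K t"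
      using b2 e0 e1 by (auto simp: d_def abs_le_iff)
    then show ?thesis using A2 q2 by (simp add: \<epsilon>_def \<beta>_def)
  qed

  let ?\<gamma> = "link_metric (1 / 36) (1 / 12)"
  have dist: "metric_dist (rescaled_metric A B t) (conical_metric ?\<gamma>) m \<le> 49 * (6 * d K t)"
    if t: "t \<ge> 4 * (D + 1)" and m: "m \<in> {1<..K} \<times> SU2 \<times> SU2" for t K m
  proof (rule metric_dist_le)
    obtain s n where sn: "m = (s, n)" "1 < s" "s \<le> K" "n \<in> SU2 \<times> SU2" using m by (cases m) auto
    fix i j :: nat assume "i \<le> 6" "j \<le> 6"
    have t0: "t \<ge> 0" using t D0 by simp
    show "\<bar>rescaled_metric A B t m (cone_frame i m) (cone_frame j m)
        - conical_metric ?\<gamma> m (cone_frame i m) (cone_frame j m)\<bar> \<le> 6 * d K t"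
      unfolding sn(1) rescaled_metric_minus_conical[OF t0]
      by (rule order_trans[OF link_metric_frame_bound[OF sn(4) \<open>i \<le> 6\<close> \<open>j \<le> 6\<close>]])
         (use close[OF sn(2,3) t refl] in simp)
  qed

  have "((\<lambda>t. SUP m \<in> {1<..K} \<times> SU2 \<times> SU2.
      ereal (metric_dist (rescaled_metric A B t) (conical_metric ?\<gamma>) m)) \<longlongrightarrow> 0) at_top"
    if K: "K > 1" for K
  proof (rule tendsto_sandwich)
    let ?S = "{1<..K} \<times> SU2 \<times> SU2"
    \<comment> \<open>A point of the index set is needed for the lower bound \<open>0\<close>: in
      \<open>ereal\<close> the supremum over an empty set is minus infinity.\<close>
    have "(K, mat 1, mat 1) \<in> ?S" using K mat_1_in_SU2 by auto
    then show "\<forall>\<^sub>F t in at_top. 0 \<le>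
        (SUP m \<in> ?S. ereal (metric_dist (rescaled_metric A B t) (conical_metric ?\<gamma>) m))"
      by (intro always_eventually allI SUP_upper2) (auto simp: metric_dist_def L2_set_nonneg)
    show "\<forall>\<^sub>F t in at_top.
        (SUP m \<in> ?S. ereal (metric_dist (rescaled_metric A B t) (conical_metric ?\<gamma>) m))
          \<le> ereal (49 * (6 * d K t))"
      using eventually_ge_at_top[of "4 * (D + 1)"]
      by eventually_elim (intro SUP_least, use dist in auto)
    have "filterlim (\<lambda>t::real. t + 1) at_top at_top"
      using filterlim_tendsto_add_at_top[OF tendsto_const filterlim_ident, of "1::real"]
      by (simp add: add.commute)
    then have "((\<lambda>t::real. c / (t + 1)) \<longlongrightarrow> 0) at_top" for c :: real
      by (intro tendsto_divide_0[OF tendsto_const] filterlim_at_top_imp_at_infinity)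
    then have "((\<lambda>t. 49 * (6 * d K t)) \<longlongrightarrow> 49 * (6 * (0 * (2 * K + D) + 0))) at_top"
      unfolding d_def by (intro tendsto_intros)
    then show "((\<lambda>t. ereal (49 * (6 * d K t))) \<longlongrightarrow> 0) at_top"
      by (simp add: zero_ereal_def)
  qed simp
  moreover have "riemannian_metric_link ?\<gamma>" by (rule riemannian_link_metric) auto
  ultimately show ?thesis by blast
qed

end
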